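(* Let $d\ge1$ be an integer and let $\rho\colon\mathcal{I}\times\mathcal{I}\to\mathbb{R}$ be a distance function. If $\sum_n 2^{n/d}r_n^*<\infty$, then there exist nonempty bounded sets $A_I\subset\mathbb{R}^d$ ($I\in\mathcal{I}$) such that (i) $A_I\subset A_J$ if $I\subset J$, (ii) $A_I\cap A_J=\emptyset$ if $I\cap J=\emptyset$, (iii) $\operatorname{dist}(A_I,A_J)\ge\rho(I,J)$ if $I\cap J=\emptyset$.
   Context: For $n\ge1$, $\mathcal{I}_n$ is the set of sequences of $0$'s and $1$'s of length $n$, and $\mathcal{I}=\bigcup_{n\ge1}\mathcal{I}_n$. For $I,J\in\mathcal{I}$ write $J\subset I$ if the sequence $J$ is a continuation of the sequence $I$ (including $J=I$), and $I\cap J=\emptyset$ if neither is a continuation of the other. A distance function is a map $\rho\colon\mathcal{I}\times\mathcal{I}\to\mathbb{R}$ such that for all $I,J,K\in\mathcal{I}$: $\rho(I,J)\ge0$, and $\rho(I,J)=0$ if $I\subset J$ or $J\subset I$; $\rho(I,J)=\rho(J,I)$; $\rho(I,K)\le\rho(J,K)$ if $J\subset I$. For $n\ge1$, $r_n^*\in[0,\infty]$ denotes the supremum of $\rho(J_1,J_2)$ over all $J_1,J_2\in\mathcal{I}$ of length at least $n$ whose first $n-1$ terms agree and whose $n$-th terms differ. *)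

theory Defs
  imports "HOL-Analysis.Analysis" "HOL-Library.Sublist"
begin

(* The letters 0 and 1 are False and True.  With I, J finite words, "J is contained in I"
   (J is a continuation of I) is prefix I J, note the order, and "I and J are disjoint"
   (neither is a continuation of the other) is parallel I J. *)

definition seqs_of_length :: "nat \<Rightarrow> bool list set" where
  "seqs_of_length n = {I. length I = n}"

definition seqs :: "bool list set" where
  "seqs = (\<Union>n\<in>{1..}. seqs_of_length n)"

(* Values of \<rho> at the empty word, which is not in seqs, are irrelevant. *)
definition distance_function :: "(bool list \<Rightarrow> bool list \<Rightarrow> real) \<Rightarrow> bool" where
  "distance_function \<rho> \<longleftrightarrow>
     (\<forall>I\<in>seqs. \<forall>J\<in>seqs. \<rho> I J \<ge> 0) \<and>
     (\<forall>I\<in>seqs. \<forall>J\<in>seqs. prefix I J \<or> prefix J I \<longrightarrow> \<rho> I J = 0) \<and>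
     (\<forall>I\<in>seqs. \<forall>J\<in>seqs. \<rho> I J = \<rho> J I) \<and>
     (\<forall>I\<in>seqs. \<forall>J\<in>seqs. \<forall>K\<in>seqs. prefix I J \<longrightarrow> \<rho> I K \<le> \<rho> J K)"

(* Meant for n \<ge> 1; the n-th term of J is J ! (n - 1).  The coercion ennreal would truncate
   negative reals to 0, but distance functions are nonnegative. *)
definition rstar :: "(bool list \<Rightarrow> bool list \<Rightarrow> real) \<Rightarrow> nat \<Rightarrow> ennreal" where
  "rstar \<rho> n =
     (SUP (J1, J2) \<in> {(J1, J2). J1 \<in> seqs \<and> J2 \<in> seqs \<and> n \<le> length J1 \<and> n \<le> length J2 \<and>
                         take (n - 1) J1 = take (n - 1) J2 \<and> J1 ! (n - 1) \<noteq> J2 ! (n - 1)}.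
        ennreal (\<rho> J1 J2))"

end

theory Submission
  imports Defs
begin

text \<open>
  The sets form a Cantor-type construction in which the \<open>n\<close>-th letter (counted from \<open>0\<close>) of a word
  decides a shift along the coordinate axis of number \<open>n mod d\<close>.  Each axis is thus
  used by every \<open>d\<close>-th letter only, and the room taken by a gap doubles with each earlier letter
  of its axis: by \<open>2 ^ k\<close> while the letter index grows by \<open>k * d\<close>.  If the letter \<open>n\<close> must leave a gap \<open>g n\<close>, the extent \<open>W n\<close>
  needed in its axis for the letters \<open>n, n + d, n + 2 * d, \<dots>\<close> therefore satisfies
  \<open>W n = g n + 2 * W (n + d)\<close>, that is \<open>W n = (\<Sum>j. 2 ^ j * g (n + j * d))\<close>; this is finite
  because the series of \<open>2 powr (n / d) * g n\<close> converges.  Shifting by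
  \<open>W n - W (n + d) = g n + W (n + d)\<close> when the letter \<open>n\<close> is \<open>True\<close> leaves a gap of at least \<open>g n\<close>
  whatever the later letters are (\<open>coord_separation\<close>), and the shifts telescope, so that
  everything stays bounded (\<open>coord_le_extent\<close>).

  Each finite word thus gets a point, and the set belonging to \<open>I\<close> consists of the points of all
  finite continuations of \<open>I\<close>, which makes the sets nonempty and nested.
  Two words that first differ in the letter \<open>n\<close> must be kept apart by at most
  \<open>rstar \<rho> (Suc n)\<close>, so gaps \<open>g n\<close> slightly above that value suffice; the surplus \<open>(1/4) ^ n\<close>
  makes the sets disjoint even where \<open>\<rho>\<close> vanishes.
\<close>

text \<open>The number \<open>W n\<close> of the introduction, in closed form.\<close>

definition extent :: "nat \<Rightarrow> (nat \<Rightarrow> real) \<Rightarrow> nat \<Rightarrow> real" where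
  "extent d g n = (\<Sum>j. 2 ^ j * g (n + j * d))"

definition shift :: "nat \<Rightarrow> (nat \<Rightarrow> real) \<Rightarrow> nat \<Rightarrow> real" where
  "shift d g n = extent d g n - extent d g (n + d)"

definition coord :: "nat \<Rightarrow> (nat \<Rightarrow> real) \<Rightarrow> nat \<Rightarrow> bool list \<Rightarrow> real" where
  "coord d g c J = (\<Sum>i | i < length J \<and> J ! i \<and> i mod d = c. shift d g i)"

text \<open>
  The terms are dominated by a subsequence of the given series, since
  \<open>j \<le> (n + j * d) / d\<close>.
\<close>

lemma summable_extent:
  assumes "d > 0" and g: "\<And>n. g n \<ge> 0"
    and sg: "summable (\<lambda>n. 2 powr (real n / real d) * g n)"
  shows "summable (\<lambda>j. 2 ^ j * g (n + j * d))"
proof (rule summable_comparison_test')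
  have "inj (\<lambda>j. n + j * d)"
    using \<open>d > 0\<close> by (auto simp: inj_def)
  then show "summable ((\<lambda>n. 2 powr (real n / real d) * g n) \<circ> (\<lambda>j. n + j * d))"
    using sg g by (intro summable_reindex) auto
next
  fix j :: nat
  have "(2::real) ^ j = 2 powr real j"
    by (simp add: powr_realpow)
  also have "\<dots> \<le> 2 powr (real (n + j * d) / real d)"
    using \<open>d > 0\<close> by (intro powr_mono) (auto simp: field_simps)
  finally show "norm (2 ^ j * g (n + j * d))
      \<le> ((\<lambda>n. 2 powr (real n / real d) * g n) \<circ> (\<lambda>j. n + j * d)) j"
    using g by (simp add: mult_right_mono)
qed

lemma extent_nonneg:
  assumes "\<And>n. g n \<ge> 0" and "\<And>n. summable (\<lambda>j. 2 ^ j * g (n + j * d))"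
  shows "extent d g n \<ge> 0"
  unfolding extent_def using assms by (intro suminf_nonneg) auto

lemma extent_rec:
  assumes s: "\<And>n. summable (\<lambda>j. 2 ^ j * g (n + j * d))"
  shows "extent d g n = g n + 2 * extent d g (n + d)"
proof -
  have "extent d g n = g n + (\<Sum>j. 2 ^ Suc j * g (n + Suc j * d))"
    using suminf_split_head[OF s[of n]] by (simp add: extent_def)
  also have "(\<lambda>j. 2 ^ Suc j * g (n + Suc j * d)) = (\<lambda>j. 2 * (2 ^ j * g ((n + d) + j * d)))"
    by (simp add: fun_eq_iff algebra_simps)
  finally show ?thesis
    using suminf_mult[OF s[of "n + d"], of 2] by (simp add: extent_def)
qed

lemma shift_eq_gap_plus_extent:
  assumes "\<And>n. summable (\<lambda>j. 2 ^ j * g (n + j * d))"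
  shows "shift d g n = g n + extent d g (n + d)"
  using extent_rec[of g d n] assms by (simp add: shift_def)

lemma shift_nonneg:
  assumes "\<And>n. g n \<ge> 0" and "\<And>n. summable (\<lambda>j. 2 ^ j * g (n + j * d))"
  shows "shift d g n \<ge> 0"
  using shift_eq_gap_plus_extent[of g d n] extent_nonneg[of g d "n + d"] assms by simp

text \<open>
  This bounds both the whole set and what the letters after a difference can contribute.
  The shifts along one residue class telescope, and the missing members of the class
  only lower the sum.
\<close>

lemma sum_shift_le_extent:
  assumes g: "\<And>n. g n \<ge> 0" and s: "\<And>n. summable (\<lambda>j. 2 ^ j * g (n + j * d))"
    and d: "d > 0" and "finite S"
    and S: "\<And>m. m \<in> S \<Longrightarrow> n \<le> m \<and> m mod d = n mod d"
  shows "sum (shift d g) S \<le> extent d g n"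
proof -
  obtain k where k: "\<And>m. m \<in> S \<Longrightarrow> m < k"
    using \<open>finite S\<close> finite_nat_set_iff_bounded by auto
  have "S \<subseteq> (\<lambda>j. n + j * d) ` {..<k}"
  proof
    fix m assume m: "m \<in> S"
    then have "d dvd m - n"
      using S[OF m] mod_eq_dvd_iff_nat by metis
    then obtain j where "m - n = d * j" ..
    then have j: "m = n + j * d"
      using S[OF m] by (metis le_add_diff_inverse mult.commute)
    have "j * 1 \<le> j * d" using d by (intro mult_le_mono2) auto
    then have "j < k" using j k[OF m] by linarith
    then show "m \<in> (\<lambda>j. n + j * d) ` {..<k}" using j by blast
  qed
  then have "sum (shift d g) S \<le> sum (shift d g) ((\<lambda>j. n + j * d) ` {..<k})"
    using shift_nonneg[OF g s] by (intro sum_mono2) auto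
  also have "\<dots> = (\<Sum>j<k. shift d g (n + j * d))"
    using d by (subst sum.reindex) (auto simp: inj_on_def)
  also have "\<dots> = (\<Sum>j<k. extent d g (n + j * d) - extent d g (n + Suc j * d))"
    by (simp add: shift_def algebra_simps)
  also have "\<dots> = extent d g n - extent d g (n + k * d)"
    using sum_lessThan_telescope'[of "\<lambda>j. extent d g (n + j * d)" k] by simp
  also have "\<dots> \<le> extent d g n"
    using extent_nonneg[OF g s] by simp
  finally show ?thesis .
qed

lemma coord_nonneg:
  assumes "\<And>n. g n \<ge> 0" and "\<And>n. summable (\<lambda>j. 2 ^ j * g (n + j * d))"
  shows "coord d g c J \<ge> 0"
  unfolding coord_def using shift_nonneg[of g d] assms by (intro sum_nonneg) auto

lemma coord_le_extent:
  assumes g: "\<And>n. g n \<ge> 0" and s: "\<And>n. summable (\<lambda>j. 2 ^ j * g (n + j * d))"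
    and "c < d"
  shows "coord d g c J \<le> extent d g c"
  unfolding coord_def using \<open>c < d\<close>
  by (intro sum_shift_le_extent[OF g s]) (auto intro: mod_less_eq_dividend)

text \<open>
  The shift for the first differing letter exceeds the gap by the total extent of all
  later shifts in the same axis, so the later letters of the second word cannot close the gap.
\<close>

lemma coord_separation:
  fixes us vs ws :: "bool list"
  assumes g: "\<And>n. g n \<ge> 0" and s: "\<And>n. summable (\<lambda>j. 2 ^ j * g (n + j * d))"
    and d: "d > 0"
  defines "n \<equiv> length us"
  shows "g n \<le> coord d g (n mod d) (us @ True # vs) - coord d g (n mod d) (us @ False # ws)"
proof -
  \<comment> \<open>\<open>P\<close> collects the shifts of the common beginning, \<open>T\<close> the later ones of the second word.\<close>
  define P where "P = {i. i < n \<and> us ! i \<and> i mod d = n mod d}"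
  define T where "T = {i. n < i \<and> i < length (us @ False # ws) \<and> (us @ False # ws) ! i
                        \<and> i mod d = n mod d}"
  have fin: "finite P" "finite T" "n \<notin> P" "P \<inter> T = {}"
    by (auto simp: P_def T_def)
  have "sum (shift d g) (insert n P) \<le> coord d g (n mod d) (us @ True # vs)"
    unfolding coord_def using shift_nonneg[OF g s]
    by (intro sum_mono2) (auto simp: P_def n_def nth_append)
  then have 1: "shift d g n + sum (shift d g) P \<le> coord d g (n mod d) (us @ True # vs)"
    using fin by simp
  have "{i. i < length (us @ False # ws) \<and> (us @ False # ws) ! i \<and> i mod d = n mod d} = P \<union> T"
  proof (rule set_eqI)
    fix i
    show "i \<in> {i. i < length (us @ False # ws) \<and> (us @ False # ws) ! i \<and> i mod d = n mod d}
            \<longleftrightarrow> i \<in> P \<union> T"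
      by (cases i n rule: linorder_cases) (auto simp: P_def T_def n_def nth_append)
  qed
  then have 2: "coord d g (n mod d) (us @ False # ws) = sum (shift d g) P + sum (shift d g) T"
    using fin by (simp add: coord_def sum.union_disjoint)
  have "sum (shift d g) T \<le> extent d g (n + d)"
  proof (rule sum_shift_le_extent[OF g s d fin(2)])
    fix m assume "m \<in> T"
    then have m: "n < m" "m mod d = n mod d" by (auto simp: T_def)
    then have "d dvd m - n"
      using mod_eq_dvd_iff_nat[of n m d] by simp
    then have "d \<le> m - n" using m by (intro dvd_imp_le) auto
    then show "n + d \<le> m \<and> m mod d = (n + d) mod d" using m by simp
  qed
  then show ?thesis
    using 1 2 shift_eq_gap_plus_extent[of g d n, OF s] by linarith
qed

lemma summable_enn2real_if_weighted_suminf_finite: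
  fixes r :: "nat \<Rightarrow> ennreal" and c :: "nat \<Rightarrow> real"
  assumes c: "\<And>n. c n > 0" and fin: "(\<Sum>n. ennreal (c n) * r n) < \<infinity>"
  shows "r n < \<infinity>" and "summable (\<lambda>n. c n * enn2real (r n))"
proof -
  have "ennreal (c n) * r n < \<infinity>" for n
    using fin ennreal_suminf_lessD by simp
  then have r: "r n < \<infinity>" for n
    using c[of n] by (metis ennreal_eq_0_iff ennreal_mult_less_top infinity_ennreal_def linorder_not_less
        not_gr_zero ennreal_mult_eq_top_iff less_top)
  show "r n < \<infinity>" by (rule r)
  have "ennreal (c n * enn2real (r n)) = ennreal (c n) * r n" for n
    using r[of n] c[of n] by (simp add: ennreal_mult)
  then show "summable (\<lambda>n. c n * enn2real (r n))"
    using fin less_imp_le[OF c] by (intro summable_suminf_not_top) auto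
qed

lemma rho_le_rstar:
  assumes "b \<noteq> c"
  shows "ennreal (\<rho> (us @ b # vs) (us @ c # ws)) \<le> rstar \<rho> (Suc (length us))"
  unfolding rstar_def
  by (rule SUP_upper2[of "(us @ b # vs, us @ c # ws)"])
     (use assms in \<open>auto simp: seqs_def seqs_of_length_def\<close>)

theorem theorem8:
  fixes \<rho> :: "bool list \<Rightarrow> bool list \<Rightarrow> real"
  assumes "distance_function \<rho>"
    and "(\<Sum>n. ennreal (2 powr (real (Suc n) / real CARD('d::finite))) * rstar \<rho> (Suc n)) < \<infinity>"
  shows "\<exists>A :: bool list \<Rightarrow> (real ^ 'd) set.
           (\<forall>I\<in>seqs. A I \<noteq> {} \<and> bounded (A I)) \<and>
           (\<forall>I\<in>seqs. \<forall>J\<in>seqs. prefix J I \<longrightarrow> A I \<subseteq> A J) \<and>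
           (\<forall>I\<in>seqs. \<forall>J\<in>seqs. parallel I J \<longrightarrow> A I \<inter> A J = {}) \<and>
           (\<forall>I\<in>seqs. \<forall>J\<in>seqs. parallel I J \<longrightarrow> setdist (A I) (A J) \<ge> \<rho> I J)"
proof -
  define d where "d = CARD('d)"
  have d: "d > 0" by (simp add: d_def)
  \<comment> \<open>Convergence of the series makes every term finite, so \<open>enn2real\<close> loses nothing.\<close>
  define r where "r n = enn2real (rstar \<rho> (Suc n))" for n
  define g where "g n = r n + (1/4) ^ n" for n
  have rfin: "rstar \<rho> (Suc n) < \<infinity>" for n
    by (rule summable_enn2real_if_weighted_suminf_finite(1)[OF _ assms(2)]) simp
  have sr: "summable (\<lambda>n. 2 powr (real (Suc n) / real d) * r n)"
    unfolding r_def d_def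
    by (rule summable_enn2real_if_weighted_suminf_finite(2)[OF _ assms(2)]) simp
  have r0: "r n \<ge> 0" for n by (simp add: r_def)
  have gr: "g n > r n" for n by (simp add: g_def)
  have g0: "g n \<ge> 0" for n using r0[of n] gr[of n] by simp
  have "summable (\<lambda>n. 2 powr (real n / real d) * g n)"
  proof (rule summable_comparison_test')
    show "summable (\<lambda>n. 2 powr (real (Suc n) / real d) * r n + (1/2) ^ n)"
      using sr by (intro summable_add summable_geometric) auto
  next
    fix n :: nat
    have "2 powr (real n / real d) * r n \<le> 2 powr (real (Suc n) / real d) * r n"
      using r0 d by (intro mult_right_mono powr_mono) (auto simp: field_simps)
    moreover have "2 powr (real n / real d) * (1/4) ^ n \<le> (1/2 :: real) ^ n"
    proof -
      have "real n * 1 \<le> real n * real d"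
        using d by (intro mult_left_mono) auto
      then have "2 powr (real n / real d) \<le> 2 powr real n"
        using d by (intro powr_mono) (auto simp: field_simps)
      then have "2 powr (real n / real d) * (1/4) ^ n \<le> 2 ^ n * (1/4 :: real) ^ n"
        by (intro mult_right_mono) (auto simp: powr_realpow)
      also have "\<dots> = (1/2) ^ n"
        by (simp flip: power_mult_distrib)
      finally show ?thesis .
    qed
    moreover have "norm (2 powr (real n / real d) * g n) = 2 powr (real n / real d) * g n"
      using g0[of n] by simp
    ultimately show "norm (2 powr (real n / real d) * g n)
        \<le> 2 powr (real (Suc n) / real d) * r n + (1/2) ^ n"
      by (simp only: g_def distrib_left)
  qed
  then have s: "summable (\<lambda>j. 2 ^ j * g (n + j * d))" for n
    by (rule summable_extent[OF d g0])

  obtain ax :: "'d \<Rightarrow> nat" where ax: "bij_betw ax UNIV {0..<d}"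
    using ex_bij_betw_finite_nat[of "UNIV :: 'd set"] by (auto simp: d_def)
  define p :: "bool list \<Rightarrow> real ^ 'd" where "p J = (\<chi> c. coord d g (ax c) J)" for J
  define A where "A I = p ` {J. prefix I J}" for I

  have "bounded (range p)"
  proof (rule bounded_subset)
    show "bounded (cbox 0 (\<chi> c. extent d g (ax c)))" by (rule bounded_cbox)
    have "ax c < d" for c using ax by (auto simp: bij_betw_def)
    then show "range p \<subseteq> cbox 0 (\<chi> c. extent d g (ax c))"
      using coord_nonneg[OF g0 s] coord_le_extent[OF g0 s]
      by (auto simp: mem_box_cart p_def)
  qed
  then have bdd: "bounded (A I)" for I
    by (rule bounded_subset) (auto simp: A_def)
  have ne: "A I \<noteq> {}" for I by (auto simp: A_def)

  have sep_TF: "g (length us) \<le> dist (p (us @ True # vs)) (p (us @ False # ws))"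
    for us vs ws
  proof -
    let ?x = "p (us @ True # vs)" and ?y = "p (us @ False # ws)"
    have "length us mod d \<in> ax ` UNIV"
      using ax d by (simp add: bij_betw_def)
    then obtain c where c: "ax c = length us mod d" by auto
    have "g (length us) \<le> (?x - ?y) $ c"
      using coord_separation[OF g0 s d] by (simp add: p_def c)
    also have "\<dots> \<le> norm (?x - ?y)"
      using component_le_norm_cart[of "?x - ?y" c] by simp
    finally show ?thesis by (simp add: dist_norm)
  qed
  have sep: "g (length us) \<le> dist x y"
    if "b \<noteq> c" and xy: "x \<in> A (us @ b # vs)" "y \<in> A (us @ c # ws)" for us b c vs ws x y
  proof -
    obtain vs' ws' where "x = p (us @ b # vs')" "y = p (us @ c # ws')"
      using xy by (auto simp: A_def prefix_def)
    then show ?thesis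
      using sep_TF[of us vs' ws'] sep_TF[of us ws' vs'] \<open>b \<noteq> c\<close>
      by (cases b; cases c) (auto simp: dist_commute)
  qed

  have par: "A I \<inter> A J = {} \<and> \<rho> I J \<le> setdist (A I) (A J)" if IJ: "parallel I J" for I J
  proof -
    obtain us b vs c ws where bc: "b \<noteq> c" and I: "I = us @ b # vs" and J: "J = us @ c # ws"
      using parallel_decomp[OF IJ] by blast
    define n where "n = length us"
    have far: "g n \<le> dist x y" if "x \<in> A I" "y \<in> A J" for x y
      using sep[OF bc] that unfolding I J n_def by blast
    have gpos: "g n > 0" using r0[of n] gr[of n] by simp
    have "A I \<inter> A J = {}"
      using far gpos by fastforce
    moreover have "\<rho> I J \<le> r n"
    proof -
      have "ennreal (\<rho> I J) \<le> ennreal (r n)"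
        using rho_le_rstar[OF bc] rfin[of n] by (simp add: I J n_def r_def)
      then show ?thesis using r0 by simp
    qed
    moreover have "g n \<le> setdist (A I) (A J)"
      using far ne by (simp add: le_setdist_iff)
    ultimately show ?thesis using gr[of n] by simp
  qed

  have mono: "A I \<subseteq> A J" if "prefix J I" for I J
    using that by (auto simp: A_def intro: prefix_order.trans)
  show ?thesis
    by (rule exI[of _ A]) (use bdd ne mono par in auto)
qed

end
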